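(* For every prime power $q$ and every integer $v>1$, $$\mathcal{G}_v(q)=(q+1)\sum_{0\le u<v}N_{v,u}(q).$$
   Context: Let $q$ be a prime power, $\mathbb{F}_q$ the field with $q$ elements and $\mathcal{P}^1(\mathbb{F}_q)=\mathbb{F}_q\cup\{\infty\}$. Let $V,U$ be nonzero polynomials over $\mathbb{F}_q$ with $\gcd(V,U)=1$, of degrees $v,u$ and leading coefficients $a_v,b_u$. The rational function $V(x)/U(x)$ is evaluated on $\mathcal{P}^1(\mathbb{F}_q)$ as follows: at $a\in\mathbb{F}_q$ its value is $V(a)/U(a)$, understood as $\infty$ if $U(a)=0$; at $\infty$ its value is $\infty$ if $v>u$, $0$ if $v<u$, and $a_v/b_v$ if $v=u$. It is a permutation rational function (PRF) if it permutes $\mathcal{P}^1(\mathbb{F}_q)$. $P_{v,u}(q)$ is the set of PRFs $V(x)/U(x)$ (as rational functions, so $V/U$ and $(cV)/(cU)$ with $c\in\mathbb{F}_q\setminus\{0\}$ are the same element) with $\deg V=v$ and $\deg U=u$, and $N_{v,u}(q)=|P_{v,u}(q)|$. The number of PRFs of degree $v$ is $\mathcal{G}_v(q)=N_{v,v}(q)+2\sum_{0\le u<v}N_{v,u}(q)$. *)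

theory Defs
  imports
    "HOL-Computational_Algebra.Polynomial"
    "HOL-Computational_Algebra.Fraction_Field"
    "HOL-Library.Cardinality"
begin

(* F_q is a type 'a of sort {field,finite} with CARD('a) = q.  The projective line over it is
   'a option, with None as the point at infinity. *)

definition ratfun_eval :: "'a::field poly \<Rightarrow> 'a poly \<Rightarrow> 'a option \<Rightarrow> 'a option" where
  "ratfun_eval V U p =
     (case p of
        Some a \<Rightarrow> if poly U a = 0 then None else Some (poly V a / poly U a)
      | None \<Rightarrow>
          if degree V > degree U then None
          else if degree V < degree U then Some 0
          else Some (lead_coeff V / lead_coeff U))"

(* Elements are taken in the fraction field of 'a poly, so V/U and (cV)/(cU) are counted once.
   The coprime representatives of a fraction differ only by a nonzero constant factor, hence
   degrees and values do not depend on the choice of V and U. *)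
definition prfs :: "nat \<Rightarrow> nat \<Rightarrow> 'a::{field,finite} poly fract set" where
  "prfs v u = {Fract V U | V U.
     V \<noteq> 0 \<and> U \<noteq> 0 \<and> coprime V U \<and> degree V = v \<and> degree U = u \<and> bij (ratfun_eval V U)}"

definition num_prfs :: "'a::{field,finite} itself \<Rightarrow> nat \<Rightarrow> nat \<Rightarrow> nat" where
  "num_prfs _ v u = card (prfs v u :: 'a poly fract set)"

definition num_prfs_of_degree :: "'a::{field,finite} itself \<Rightarrow> nat \<Rightarrow> nat" where
  "num_prfs_of_degree T v = num_prfs T v v + 2 * (\<Sum>u<v. num_prfs T v u)"

end

(* Post-composing with the bijection y \<mapsto> c + 1/y of the projective line turns a PRF sending infinity
   to infinity into a PRF sending infinity to c. For c \<noteq> 0 the results are exactly the PRFs whose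
   numerator and denominator have the same degree, and c is recovered as the value at infinity, so
   N_{v,v} = (q - 1) * (\<Sum>u<v. N_{v,u}). *)
theory Submission
  imports Defs
begin

lemma finite_poly_degree_le: "finite {p :: 'a::{zero,finite} poly. degree p \<le> n}"
proof (rule finite_subset)
  show "{p :: 'a poly. degree p \<le> n} \<subseteq> Poly ` {xs. set xs \<subseteq> UNIV \<and> length xs \<le> Suc n}"
  proof
    fix p :: "'a poly"
    assume "p \<in> {p. degree p \<le> n}"
    then have "length (coeffs p) \<le> Suc n"
      \<comment> \<open>The zero polynomial has an empty coefficient list; any other has exactly
        \<open>degree p + 1\<close> entries.\<close>
      by (cases "p = 0") (auto simp: length_coeffs_degree)
    then show "p \<in> Poly ` {xs. set xs \<subseteq> UNIV \<and> length xs \<le> Suc n}"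
      by (intro image_eqI[of _ _ "coeffs p"]) auto
  qed
  show "finite (Poly ` {xs :: 'a list. set xs \<subseteq> UNIV \<and> length xs \<le> Suc n})"
    by (intro finite_imageI finite_lists_length_le) simp
qed

lemma coprime_poly_no_common_root:
  fixes V U :: "'a::field poly"
  assumes "coprime V U"
  shows "poly V a \<noteq> 0 \<or> poly U a \<noteq> 0"
proof (rule ccontr)
  assume "\<not> ?thesis"
  then have "[:-a, 1:] dvd V" "[:-a, 1:] dvd U"
    by (simp_all add: poly_eq_0_iff_dvd)
  then have "is_unit [:-a, 1:]"
    using assms coprime_common_divisor by blast
  then show False
    by (simp add: is_unit_iff_degree)
qed

lemma degree_smult_add_eq:
  fixes W T :: "'a::field poly"
  assumes "c \<noteq> 0" "degree T < degree W"
  shows "degree (smult c W + T) = degree W"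
  using assms by (simp add: degree_add_eq_left)

lemma lead_coeff_smult_add:
  fixes W T :: "'a::field poly"
  assumes "c \<noteq> 0" "degree T < degree W"
  shows "lead_coeff (smult c W + T) = c * lead_coeff W"
  using assms by (simp add: degree_smult_add_eq coeff_eq_0)

text \<open>One step of the Euclidean algorithm: modulo \<open>W\<close> the two polynomials
  \<open>smult c W + T\<close> and \<open>T\<close> agree, so they share the same common divisors
  with \<open>W\<close>.\<close>

lemma coprime_smult_add_iff:
  fixes W T :: "'a::field poly"
  shows "coprime (smult c W + T) W \<longleftrightarrow> coprime W T"
proof -
  have "d dvd smult c W + T \<longleftrightarrow> d dvd T" if "d dvd W" for d
    using that by (simp add: dvd_add_right_iff dvd_smult)
  then show ?thesis
    by (auto simp: coprime_def)
qed

definition shift_recip :: "'a::field \<Rightarrow> 'a option \<Rightarrow> 'a option" where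
  "shift_recip c p = (case p of None \<Rightarrow> Some c | Some x \<Rightarrow> if x = 0 then None else Some (c + 1 / x))"

lemma bij_shift_recip: "bij (shift_recip c)"
proof (rule o_bij)
  let ?g = "\<lambda>p. case p of None \<Rightarrow> Some 0 | Some y \<Rightarrow> if y = c then None else Some (1 / (y - c))"
  show "?g \<circ> shift_recip c = id" "shift_recip c \<circ> ?g = id"
    by (auto simp: shift_recip_def fun_eq_iff split: option.splits)
qed

text \<open>Formally (cW + T)/W = c + 1/(W/T), so only the special points matter. At infinity W/T
  takes the value infinity, while the left side is a quotient of polynomials of equal degree with
  leading coefficient ratio c. At a root of \<open>W\<close> or \<open>T\<close>, coprimality keeps
  the other polynomial nonzero, so 0 goes to infinity and infinity to c as required.\<close>

lemma ratfun_eval_smult_add: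
  fixes W T :: "'a::field poly"
  assumes "coprime W T" "c \<noteq> 0" "degree T < degree W"
  shows "ratfun_eval (smult c W + T) W = shift_recip c \<circ> ratfun_eval W T"
proof
  fix p
  show "ratfun_eval (smult c W + T) W p = (shift_recip c \<circ> ratfun_eval W T) p"
  proof (cases p)
    case None
    moreover have "W \<noteq> 0"
      using assms(3) by auto
    ultimately show ?thesis
      using assms degree_smult_add_eq[OF assms(2,3)] lead_coeff_smult_add[OF assms(2,3)]
      by (simp add: ratfun_eval_def shift_recip_def)
  next
    case (Some a)
    then show ?thesis
      using coprime_poly_no_common_root[OF assms(1), of a]
      by (auto simp: ratfun_eval_def shift_recip_def field_simps)
  qed
qed

text \<open>Composing with a bijection neither creates nor destroys bijectivity. The two inclusions
  of \<open>image_shift_recip_prfs\<close> use opposite directions of this equivalence.\<close>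

lemma bij_ratfun_eval_smult_add_iff:
  fixes W T :: "'a::field poly"
  assumes "coprime W T" "c \<noteq> 0" "degree T < degree W"
  shows "bij (ratfun_eval (smult c W + T) W) \<longleftrightarrow> bij (ratfun_eval W T)"
proof -
  have "bij (shift_recip c \<circ> f) \<longleftrightarrow> bij f" for f :: "'a option \<Rightarrow> 'a option"
    using bij_betw_comp_iff2[OF bij_shift_recip[of c], of f UNIV] by simp
  then show ?thesis
    using ratfun_eval_smult_add[OF assms] by simp
qed

text \<open>The same map y \<mapsto> c + 1/y, now as an algebraic operation on the fraction field,
  where PRFs are counted.\<close>

lemma shift_recip_Fract:
  fixes W T :: "'a::field poly"
  assumes "W \<noteq> 0" "T \<noteq> 0"
  shows "Fract [:c:] 1 + inverse (Fract W T) = Fract (smult c W + T) W"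
  using assms by simp

lemma finite_prfs: "finite (prfs v u :: 'a::{field,finite} poly fract set)"
proof (rule finite_subset)
  let ?D = "\<lambda>n. {p :: 'a poly. degree p \<le> n}"
  show "prfs v u \<subseteq> (\<lambda>(V, U). Fract V U) ` (?D v \<times> ?D u)"
    unfolding prfs_def by auto
  show "finite ((\<lambda>(V, U). Fract V U) ` (?D v \<times> ?D u))"
    by (intro finite_imageI finite_cartesian_product finite_poly_degree_le)
qed

text \<open>Cross-multiplying shows that deg V - deg U depends only on the fraction V/U, so a fixed
  numerator degree determines the denominator degree.\<close>

lemma prfs_disjoint:
  assumes "u \<noteq> u'"
  shows "(prfs v u :: 'a::{field,finite} poly fract set) \<inter> prfs v u' = {}"
proof (rule ccontr)
  assume "\<not> ?thesis"
  then obtain V U V' U' :: "'a poly"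
    where *: "Fract V U = Fract V' U'" "V \<noteq> 0" "U \<noteq> 0" "V' \<noteq> 0" "U' \<noteq> 0"
      "degree V = v" "degree V' = v" "degree U = u" "degree U' = u'"
    unfolding prfs_def by auto
  then have "degree (V * U') = degree (V' * U)"
    by (simp add: eq_fract)
  with * assms show False
    by (simp add: degree_mult_eq)
qed

lemma inj_on_shift_recip_prfs:
  "inj_on (\<lambda>(c, g). Fract [:c:] 1 + inverse g)
     ((UNIV - {0}) \<times> (\<Union>u<v. prfs v u :: 'a::{field,finite} poly fract set))"
proof -
  have *: "c = c' \<and> g = g'"
    if c: "c \<noteq> 0" "c' \<noteq> 0" and u: "u < v" "u' < v"
      and g: "g \<in> prfs v u" "g' \<in> prfs v u'"
      and eq: "Fract [:c:] 1 + inverse g = Fract [:c':] 1 + inverse g'"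
    for c c' :: 'a and g g' :: "'a poly fract" and u u'
  proof -
    obtain W T where WT: "g = Fract W T" "W \<noteq> 0" "T \<noteq> 0" "degree T < degree W"
      using g(1) u(1) unfolding prfs_def by blast
    obtain W' T' where WT': "g' = Fract W' T'" "W' \<noteq> 0" "T' \<noteq> 0" "degree T' < degree W'"
      using g(2) u(2) unfolding prfs_def by blast
    have "(smult c W + T) * W' = (smult c' W' + T') * W"
      using eq WT(2) WT'(2)
      unfolding WT(1) WT'(1) shift_recip_Fract[OF WT(2,3)] shift_recip_Fract[OF WT'(2,3)]
      by (simp add: eq_fract)
    \<comment> \<open>Algebraic form of comparing values at infinity: \<open>T\<close> and
      \<open>T'\<close> have too small a degree to affect the leading coefficients.\<close>
    then have "lead_coeff ((smult c W + T) * W') = lead_coeff ((smult c' W' + T') * W)"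
      by simp
    then have "c * lead_coeff W * lead_coeff W' = c' * lead_coeff W' * lead_coeff W"
      unfolding lead_coeff_mult lead_coeff_smult_add[OF c(1) WT(4)] lead_coeff_smult_add[OF c(2) WT'(4)] .
    then have "c = c'"
      using WT(2) WT'(2) by simp
    \<comment> \<open>Once the constants agree, they cancel, and \<open>inverse\<close> is injective
      on the field.\<close>
    with eq show ?thesis
      by simp
  qed
  show ?thesis
  proof (rule inj_onI)
    fix x y :: "'a \<times> 'a poly fract"
    assume x: "x \<in> (UNIV - {0}) \<times> (\<Union>u<v. prfs v u)" and y: "y \<in> (UNIV - {0}) \<times> (\<Union>u<v. prfs v u)"
      and eq: "(case x of (c, g) \<Rightarrow> Fract [:c:] 1 + inverse g) = (case y of (c, g) \<Rightarrow> Fract [:c:] 1 + inverse g)"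
    obtain c g u where x': "x = (c, g)" "c \<noteq> 0" "u < v" "g \<in> prfs v u"
      using x by blast
    obtain c' g' u' where y': "y = (c', g')" "c' \<noteq> 0" "u' < v" "g' \<in> prfs v u'"
      using y by blast
    show "x = y"
      using *[OF x'(2) y'(2) x'(3) y'(3) x'(4) y'(4)] eq x'(1) y'(1) by (simp only: prod.case Pair_inject simp_thms)
  qed
qed

lemma image_shift_recip_prfs:
  assumes "v > 0"
  shows "(\<lambda>(c, g). Fract [:c:] 1 + inverse g) ` ((UNIV - {0}) \<times> (\<Union>u<v. prfs v u))
    = (prfs v v :: 'a::{field,finite} poly fract set)" (is "?f ` ?D = _")
proof (rule Set.equalityI; rule subsetI)
  fix h
  assume "h \<in> ?f ` ?D"
  then obtain c g u where h: "h = Fract [:c:] 1 + inverse g"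
    and c: "c \<noteq> 0" and u: "u < v" and g: "g \<in> prfs v u"
    by auto
  obtain W T where WT: "g = Fract W T" "W \<noteq> 0" "T \<noteq> 0" "coprime W T"
    "degree W = v" "degree T = u" "bij (ratfun_eval W T)"
    using g unfolding prfs_def by blast
  have less: "degree T < degree W"
    using WT u by simp
  \<comment> \<open>As c is nonzero, cW dominates \<open>T\<close>, so the new numerator has the
    same degree as the denominator \<open>W\<close>.\<close>
  have deg: "degree (smult c W + T) = v"
    using degree_smult_add_eq[OF c less] WT(5) by simp
  then have "smult c W + T \<noteq> 0"
    using assms by auto
  moreover have "bij (ratfun_eval (smult c W + T) W)"
    using bij_ratfun_eval_smult_add_iff[OF WT(4) c less] WT(7) by simp
  moreover have "h = Fract (smult c W + T) W"
    unfolding h WT(1) using WT(2,3) by (rule shift_recip_Fract)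
  ultimately show "h \<in> prfs v v"
    unfolding prfs_def using WT deg coprime_smult_add_iff by blast
next
  fix h :: "'a poly fract"
  assume "h \<in> prfs v v"
  then obtain V U where VU: "h = Fract V U" "V \<noteq> 0" "U \<noteq> 0" "coprime V U"
    "degree V = v" "degree U = v" "bij (ratfun_eval V U)"
    unfolding prfs_def by blast
  \<comment> \<open>Here c is the value of V/U at infinity and \<open>T\<close> the remainder of
    \<open>V\<close> on division by \<open>U\<close>. Solving h = c + 1/g gives the preimage g =
    U/T.\<close>
  define c where "c = lead_coeff V / lead_coeff U"
  define T where "T = V - smult c U"
  have c: "c \<noteq> 0"
    using VU(2,3) by (simp add: c_def)
  have V: "V = smult c U + T"
    by (simp add: T_def)
  have cop: "coprime U T"
    using VU(4) by (simp only: V coprime_smult_add_iff)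
  \<comment> \<open>Otherwise V/U would be the constant c; coprimality would then force
    \<open>U\<close> to be constant, against v > 0.\<close>
  have T0: "T \<noteq> 0"
  proof
    assume "T = 0"
    then have "is_unit U"
      using cop by simp
    then show False
      using VU(3,6) assms by (simp add: is_unit_iff_degree)
  qed
  \<comment> \<open>The choice of c cancels the coefficient of degree v.\<close>
  have "degree T \<noteq> v"
  proof
    assume "degree T = v"
    moreover have "coeff T v = 0"
      using VU(3) by (simp add: T_def c_def VU(5,6) flip: leading_coeff_0_iff)
    ultimately show False
      using T0 leading_coeff_0_iff by blast
  qed
  moreover have "degree T \<le> v"
    unfolding T_def using VU(5,6) c by (intro degree_diff_le) auto
  ultimately have less: "degree T < v"
    by simp
  have "bij (ratfun_eval U T)"
    using bij_ratfun_eval_smult_add_iff[OF cop c] less VU(6,7) by (simp add: V[symmetric])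
  then have "Fract U T \<in> prfs v (degree T)"
    unfolding prfs_def using VU(3,6) T0 cop by blast
  then have "(c, Fract U T) \<in> ?D"
    using less c by auto
  moreover have "h = ?f (c, Fract U T)"
    using shift_recip_Fract[OF VU(3) T0, of c] VU(1) V by simp
  ultimately show "h \<in> ?f ` ?D"
    by blast
qed

theorem theorem2p4:
  fixes q v :: nat
  assumes "CARD('a::{field,finite}) = q"
    and "v > 1"
  shows "num_prfs_of_degree TYPE('a) v = (q + 1) * (\<Sum>u<v. num_prfs TYPE('a) v u)"
proof -
  let ?A = "\<Union>u<v. prfs v u :: 'a poly fract set"
  let ?S = "\<Sum>u<v. num_prfs TYPE('a) v u"
  have A: "card ?A = ?S"
    unfolding num_prfs_def
    by (rule card_UN_disjoint) (auto simp: finite_prfs prfs_disjoint)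
  have "num_prfs TYPE('a) v v = card ((UNIV - {0 :: 'a}) \<times> ?A)"
    unfolding num_prfs_def
    using assms(2) by (subst image_shift_recip_prfs[symmetric])
      (auto intro: card_image inj_on_shift_recip_prfs)
  \<comment> \<open>The factor q - 1 counts the nonzero constants c.\<close>
  also have "\<dots> = (q - 1) * ?S"
    using assms(1) by (simp add: card_cartesian_product A card_Diff_singleton)
  finally have "num_prfs_of_degree TYPE('a) v = (q - 1) * ?S + 2 * ?S"
    by (simp add: num_prfs_of_degree_def)
  also have "\<dots> = (q + 1) * ?S"
  proof -
    \<comment> \<open>Subtraction on naturals is truncated, so (q - 1) + 2 = q + 1 fails at q =
      0.\<close>
    have "q > 0"
      using assms(1) by (metis finite zero_less_card_finite)
    then show ?thesis
      by (cases q) auto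
  qed
  finally show ?thesis .
qed

end
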